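(* Let $p$ be an odd prime. For $n\ge 1$ let $\mathcal{B}_n=B_n/n$, where $B_n$ is the $n$-th Bernoulli number (with $B_1=-\tfrac12$). Let $M_{p-2}$ be the number of permutations of $p-2$ letters that have an even number of ascents and are distinct from the identity. Then $$\sum_{k=1}^{p-2}\frac{\mathcal{B}_k}{2^k}\equiv\frac{p\,B_{p-1}+1}{p}+2M_{p-2}\pmod p.$$
   Context: Congruences are taken in the ring $\mathbb{Z}_p$ of $p$-adic integers: $x\equiv y \pmod{p^r}$ means $x-y\in p^r\mathbb{Z}_p$. The quantity $\frac{pB_{p-1}+1}{p}$ (the Agoh–Giuga quotient) lies in $\mathbb{Z}_p$. For a permutation $(i_1,\dots,i_n)$ of $\{1,\dots,n\}$ (mapping $j$ to $i_j$), an ascent is an index $k$ with $i_{k+1}>i_k$. *)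

theory Defs
  imports
    "HOL-Computational_Algebra.Computational_Algebra"
    "HOL-Combinatorics.Permutations"
begin

text \<open>
  Exponential generating function \<open>x / (e\<^sup>x - 1)\<close>; the quotient is the exact one (both series
  have order 1), and the convention is \<open>B\<^sub>1 = - 1/2\<close>.
\<close>
definition bernoulli :: "nat \<Rightarrow> rat" where
  "bernoulli n = fact n * fps_nth (fps_X / (fps_exp 1 - 1)) n"

definition divided_bernoulli :: "nat \<Rightarrow> rat" where
  "divided_bernoulli n = bernoulli n / of_nat n"

text \<open>
  For a prime \<open>p\<close>, the rational \<open>p\<close>-adic integers, that is, the intersection of the rationals with
  the ring of \<open>p\<close>-adic integers: fractions whose denominator is prime to \<open>p\<close>. A difference of
  rationals lies in \<open>p\<^sup>r\<close> times the ring of \<open>p\<close>-adic integers iff it is \<open>p\<^sup>r\<close> times an element of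
  this set, so \<open>padic_cong\<close> is the \<open>p\<close>-adic congruence restricted to rational arguments.
\<close>
definition rat_padic_ints :: "nat \<Rightarrow> rat set" where
  "rat_padic_ints p = {of_int a / of_int b | a b. \<not> int p dvd b}"

definition padic_cong :: "nat \<Rightarrow> nat \<Rightarrow> rat \<Rightarrow> rat \<Rightarrow> bool" where
  "padic_cong p r x y \<longleftrightarrow> (\<exists>u\<in>rat_padic_ints p. x - y = of_nat p ^ r * u)"

definition ascents :: "nat \<Rightarrow> (nat \<Rightarrow> nat) \<Rightarrow> nat set" where
  "ascents n f = {k. 1 \<le> k \<and> k < n \<and> f (k + 1) > f k}"

definition even_ascent_perms :: "nat \<Rightarrow> (nat \<Rightarrow> nat) set" where
  "even_ascent_perms n = {f. f permutes {1..n} \<and> even (card (ascents n f)) \<and> f \<noteq> id}"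

definition M :: "nat \<Rightarrow> nat" where
  "M n = card (even_ascent_perms n)"

end

theory Submission
  imports Defs "HOL-Number_Theory.Number_Theory"
begin

text \<open>
  Write \<open>q(a) = (a\<^bsup>p - 1\<^esup> - 1) / p\<close> and \<open>S(m) = 1\<^sup>m + \<dots> + (p - 1)\<^sup>m\<close>. Faulhaber's formula gives
  \<open>S(k) \<equiv> p B\<^sub>k\<close> modulo \<open>p\<^sup>2\<close> for \<open>1 \<le> k \<le> p - 1\<close>; combined with the Kummer-type congruence
  \<open>k S(k + p - 1) \<equiv> (k - 1) S(k)\<close> modulo \<open>p\<^sup>2\<close> it yields \<open>B\<^sub>k / k \<equiv> - \<Sum>\<^sub>a a\<^sup>k q(a)\<close> modulo \<open>p\<close>. Multiplying
  by \<open>2\<^bsup>- k\<^esup>\<close> and summing the geometric series in \<open>a / 2\<close>, where only \<open>a = 2\<close> is exceptional, turns the left-hand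
  side into \<open>\<Sum>\<^sub>a q(a) + q(2)\<close>. The case \<open>k = p - 1\<close> shows that the Agoh-Giuga quotient is
  \<open>1 + \<Sum>\<^sub>a q(a)\<close>.

  It remains to see that \<open>2 M\<^bsub>p - 2\<^esub> \<equiv> q(2) - 1\<close>. By Wilson's theorem this says that the Eulerian
  polynomial of order \<open>p - 2\<close> takes the value \<open>q(2)\<close> at \<open>- 1\<close>. Modulo \<open>p\<close> its coefficients are the harmonic
  numbers, so this value is \<open>\<Sum> 1 / i\<close> over the odd \<open>i < p\<close>, which is \<open>q(2)\<close> because \<open>2\<^bsup>p - 1\<^esup>\<close> is the sum of
  the binomial coefficients of \<open>p\<close> at odd indices.
\<close>

section \<open>Ascents and the last value of a permutation\<close>

text \<open>Recording the last value makes a recursion in \<open>n\<close> possible: whether an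
  appended entry creates an ascent depends only on that entry and the last value. Power series leave
  room for a closed form with an infinite series.\<close>

definition ascent_gf :: "nat \<Rightarrow> nat \<Rightarrow> int fps" where
  "ascent_gf n v = (\<Sum>f | f permutes {1..n} \<and> f n = v. fps_X ^ card (ascents n f))"

lemma finite_ascents [simp]: "finite (ascents n f)"
  unfolding ascents_def by (rule finite_subset[of _ "{..<n}"]) auto

text \<open>
  Composing a permutation of \<open>{1..n}\<close> with this map prescribes the value \<open>v\<close> at the new last position
  \<open>n + 1\<close> and keeps the relative order of the other values.
\<close>
definition raise_above :: "nat \<Rightarrow> nat \<Rightarrow> nat \<Rightarrow> nat" where
  "raise_above n v j = (if v \<le> j \<and> j \<le> n then j + 1 else if j = n + 1 then v else j)"

lemma raise_above_permutes:
  assumes "v \<in> {1..n + 1}"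
  shows "raise_above n v permutes {1..n + 1}"
proof (rule bij_imp_permutes)
  let ?t = "\<lambda>j. if j = v then n + 1 else if v < j \<and> j \<le> n + 1 then j - 1 else j"
  show "bij_betw (raise_above n v) {1..n + 1} {1..n + 1}"
    by (rule bij_betw_byWitness[where f' = ?t])
       (use assms in \<open>auto simp: raise_above_def split: if_splits\<close>)
qed (use assms in \<open>auto simp: raise_above_def\<close>)

text \<open>\<open>raise_above n v\<close> is strictly increasing on \<open>{1..n}\<close>, so the
  old ascents survive. The one new position is \<open>n\<close>, where the raised value of
  \<open>f n\<close> stays below \<open>v\<close> iff \<open>f n < v\<close>.\<close>

lemma ascents_raise_above:
  assumes n: "n \<ge> 1" and v: "v \<in> {1..n + 1}" and f: "f permutes {1..n}"
  shows "card (ascents (n + 1) (raise_above n v \<circ> f)) =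
           card (ascents n f) + (if f n < v then 1 else 0)"
proof -
  have r: "f k \<in> {1..n}" if "k \<in> {1..n}" for k
    using permutes_in_image[OF f] that by blast
  have mono: "raise_above n v x < raise_above n v y \<longleftrightarrow> x < y"
    if "x \<in> {1..n}" "y \<in> {1..n}" for x y
    using that by (auto simp: raise_above_def)
  have last: "raise_above n v (f (n + 1)) = v"
    using permutes_not_in[OF f, of "n + 1"] by (simp add: raise_above_def)
  have top: "raise_above n v (f n) < v \<longleftrightarrow> f n < v"
    using r[of n] n by (auto simp: raise_above_def)
  have "k \<in> ascents (n + 1) (raise_above n v \<circ> f) \<longleftrightarrow>
          k \<in> ascents n f \<union> (if f n < v then {n} else {})" for k
  proof (cases "k = n")
    case True
    then show ?thesis using n last top by (auto simp: ascents_def)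
  next
    case False
    then show ?thesis
      using mono[OF r r, of k "k + 1"] by (auto simp: ascents_def)
  qed
  then have "ascents (n + 1) (raise_above n v \<circ> f) =
               ascents n f \<union> (if f n < v then {n} else {})" by blast
  moreover have "n \<notin> ascents n f" by (simp add: ascents_def)
  ultimately show ?thesis by simp
qed

text \<open>Since \<open>raise_above n v\<close> sends \<open>n + 1\<close> to \<open>v\<close>,
  undoing it on a permutation ending in \<open>v\<close> fixes \<open>n + 1\<close> and leaves a
  permutation of \<open>{1..n}\<close>.\<close>

lemma bij_betw_raise_above:
  assumes v: "v \<in> {1..n + 1}"
  shows "bij_betw (\<lambda>f. raise_above n v \<circ> f) {f. f permutes {1..n}}
           {g. g permutes {1..n + 1} \<and> g (n + 1) = v}"
proof (rule bij_betw_byWitness[where f' = "\<lambda>g. inv_into UNIV (raise_above n v) \<circ> g"])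
  let ?r = "raise_above n v"
  note r = raise_above_permutes[OF v]
  show "\<forall>f\<in>{f. f permutes {1..n}}. inv_into UNIV ?r \<circ> (?r \<circ> f) = f"
    using permutes_inv_o(2)[OF r] by (simp add: o_assoc)
  show "\<forall>g\<in>{g. g permutes {1..n + 1} \<and> g (n + 1) = v}. ?r \<circ> (inv_into UNIV ?r \<circ> g) = g"
    using permutes_inv_o(1)[OF r] by (simp add: o_assoc)
  show "(\<lambda>f. ?r \<circ> f) ` {f. f permutes {1..n}} \<subseteq> {g. g permutes {1..n + 1} \<and> g (n + 1) = v}"
  proof clarify
    fix f assume f: "f permutes {1..n}"
    then have "f permutes {1..n + 1}" by (rule permutes_subset) auto
    then have "(?r \<circ> f) permutes {1..n + 1}" using r by (rule permutes_compose)
    moreover have "(?r \<circ> f) (n + 1) = v"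
      using permutes_not_in[OF f, of "n + 1"] by (simp add: raise_above_def)
    ultimately show "(?r \<circ> f) permutes {1..n + 1} \<and> (?r \<circ> f) (n + 1) = v" by simp
  qed
  show "(\<lambda>g. inv_into UNIV ?r \<circ> g) ` {g. g permutes {1..n + 1} \<and> g (n + 1) = v} \<subseteq> {f. f permutes {1..n}}"
  proof (rule image_subsetI)
    fix g assume "g \<in> {g. g permutes {1..n + 1} \<and> g (n + 1) = v}"
    then have g: "g permutes {1..n + 1}" and gv: "g (n + 1) = v" by auto
    have "(inv_into UNIV ?r \<circ> g) permutes {1..n + 1}"
      using g permutes_inv[OF r] by (rule permutes_compose)
    moreover have "?r (n + 1) = v" by (simp add: raise_above_def)
    then have "inv_into UNIV ?r v = n + 1" using permutes_inverses(2)[OF r, of "n + 1"] by simp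
    then have "(inv_into UNIV ?r \<circ> g) (n + 1) = n + 1" using gv by simp
    then have "\<forall>x\<in>{1..n + 1} - {1..n}. (inv_into UNIV ?r \<circ> g) x = x"
      by (auto simp del: o_apply simp: le_Suc_eq)
    ultimately show "inv_into UNIV ?r \<circ> g \<in> {f. f permutes {1..n}}"
      using permutes_superset by blast
  qed
qed

lemma ascent_gf_Suc:
  assumes n: "n \<ge> 1" and v: "v \<in> {1..n + 1}"
  shows "ascent_gf (n + 1) v = (\<Sum>u\<in>{1..n}. (if u < v then fps_X else 1) * ascent_gf n u)"
proof -
  let ?P = "{f. f permutes {1..n}}"
  have fin: "finite ?P" by (rule finite_permutations) simp
  have img: "(\<lambda>f. f n) ` ?P \<subseteq> {1..n}"
    using n by (auto dest: permutes_in_image[where x = n])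
  have "ascent_gf (n + 1) v = (\<Sum>f\<in>?P. fps_X ^ card (ascents (n + 1) (raise_above n v \<circ> f)))"
    unfolding ascent_gf_def
    by (rule sum.reindex_bij_betw[OF bij_betw_raise_above[OF v], symmetric])
  also have "\<dots> = (\<Sum>f\<in>?P. (if f n < v then fps_X else 1) * fps_X ^ card (ascents n f))"
    by (intro sum.cong refl, subst ascents_raise_above[OF n v]) (simp_all add: power_add)
  also have "\<dots> = (\<Sum>u\<in>{1..n}. \<Sum>f\<in>{f \<in> ?P. f n = u}.
                    (if f n < v then fps_X else 1) * fps_X ^ card (ascents n f))"
    by (rule sum.group[OF fin _ img, symmetric]) simp
  also have "\<dots> = (\<Sum>u\<in>{1..n}. (if u < v then fps_X else 1) * ascent_gf n u)"
    unfolding ascent_gf_def sum_distrib_left by (intro sum.cong) auto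
  finally show ?thesis .
qed

text \<open>Appending the smallest value creates no ascent, so \<open>v = 1\<close> recovers the
  full Eulerian polynomial of order \<open>n\<close>.\<close>

lemma sum_ascent_gf:
  assumes "n \<ge> 1"
  shows "ascent_gf (n + 1) 1 = (\<Sum>f | f permutes {1..n}. fps_X ^ card (ascents n f))"
proof -
  let ?P = "{f. f permutes {1..n}}"
  have fin: "finite ?P" by (rule finite_permutations) simp
  have img: "(\<lambda>f. f n) ` ?P \<subseteq> {1..n}"
    using assms by (auto dest: permutes_in_image[where x = n])
  have "ascent_gf (n + 1) 1 = (\<Sum>u\<in>{1..n}. \<Sum>f\<in>{f \<in> ?P. f n = u}. fps_X ^ card (ascents n f))"
    using assms by (subst ascent_gf_Suc) (auto simp: ascent_gf_def intro!: sum.cong)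
  also have "\<dots> = (\<Sum>f\<in>?P. fps_X ^ card (ascents n f))"
    by (rule sum.group[OF fin _ img]) simp
  finally show ?thesis .
qed

section \<open>Closed form of the refined Eulerian generating functions\<close>

text \<open>Multiplying each term by \<open>1 = (x + 1) - x\<close> writes it as a difference of
  neighbours.\<close>

lemma sum_telescope_powers:
  fixes x :: int
  assumes "a \<le> b" and "b \<le> n + 1" and "a \<ge> 1"
  shows "(\<Sum>u\<in>{a..<b}. x ^ (u - 1) * (x + 1) ^ (n - u)) =
           x ^ (a - 1) * (x + 1) ^ (n + 1 - a) - x ^ (b - 1) * (x + 1) ^ (n + 1 - b)"
  using assms
proof (induction b rule: dec_induct)
  case (step b)
  then obtain d where d: "n = b + d" by (metis Suc_eq_plus1 Suc_le_mono le_Suc_ex)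
  from step obtain c where c: "b = Suc c" by (cases b) auto
  have "Suc n - Suc c = Suc d" "n - Suc c = d" "Suc n - Suc (Suc c) = d" using c d by auto
  with step c show ?case by (simp add: algebra_simps)
qed simp

text \<open>A refinement of Carlitz's identity, which is the case \<open>v = 1\<close>. In the
  recursion the values \<open>u \<ge> v\<close> contribute at \<open>m\<close> and, because of the
  factor \<open>fps_X\<close>, the values \<open>u < v\<close> at \<open>m - 1\<close>. Both sums
  telescope, their common end \<open>m ^ n\<close> cancels, and a factor \<open>1 - fps_X\<close>
  remains.\<close>

lemma ascent_gf_eq:
  assumes "n \<ge> 1" and "v \<in> {1..n}"
  shows "ascent_gf n v =
    (1 - fps_X) ^ n * Abs_fps (\<lambda>m. int m ^ (v - 1) * (int m + 1) ^ (n - v))"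
  using assms
proof (induction n arbitrary: v rule: dec_induct)
  case base
  have "{f. f permutes {1..1::nat} \<and> f 1 = 1} = {id}"
    by auto
  moreover have "ascents 1 id = {}" by (auto simp: ascents_def)
  ultimately have "ascent_gf 1 1 = 1" by (simp add: ascent_gf_def)
  moreover have "(1 - fps_X) * Abs_fps (\<lambda>m. 1 :: int) = 1"
    by (rule fps_ext) (auto simp: left_diff_distrib fps_one_nth)
  ultimately show ?case using base by simp
next
  case (step n)
  define G where "G n v = Abs_fps (\<lambda>m. int m ^ (v - 1) * (int m + 1) ^ (n - v))" for n v
  have "(\<Sum>u\<in>{1..n}. (if u < v then fps_X else 1) * G n u) = (1 - fps_X) * G (n + 1) v"
  proof (rule fps_ext)
    fix m
    have split: "{1..n} = {1..<v} \<union> {v..<n + 1}" using step.prems by auto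
    have "fps_nth (\<Sum>u\<in>{1..n}. (if u < v then fps_X else 1) * G n u) m =
        (\<Sum>u\<in>{1..<v}. fps_nth ((if u < v then fps_X else 1) * G n u) m) +
        (\<Sum>u\<in>{v..<n + 1}. fps_nth ((if u < v then fps_X else 1) * G n u) m)"
      unfolding fps_sum_nth split by (rule sum.union_disjoint) auto
    also have "(\<Sum>u\<in>{v..<n + 1}. fps_nth ((if u < v then fps_X else 1) * G n u) m) =
        (\<Sum>u\<in>{v..<n + 1}. int m ^ (u - 1) * (int m + 1) ^ (n - u))"
      by (rule sum.cong) (auto simp: G_def)
    also have "\<dots> = int m ^ (v - 1) * (int m + 1) ^ (n + 1 - v) - int m ^ n"
      using step.prems by (subst sum_telescope_powers) auto
    also have "(\<Sum>u\<in>{1..<v}. fps_nth ((if u < v then fps_X else 1) * G n u) m) =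
        (if m = 0 then 0 else \<Sum>u\<in>{1..<v}. int (m - 1) ^ (u - 1) * (int (m - 1) + 1) ^ (n - u))"
      by (auto simp: G_def intro!: sum.cong)
    also have "\<dots> = (if m = 0 then 0
        else int m ^ n - int (m - 1) ^ (v - 1) * int m ^ (n + 1 - v))"
      using step.prems by (subst sum_telescope_powers) (auto simp: of_nat_diff)
    finally show "fps_nth (\<Sum>u\<in>{1..n}. (if u < v then fps_X else 1) * G n u) m =
        fps_nth ((1 - fps_X) * G (n + 1) v) m"
      \<comment> \<open>At \<open>m = 0\<close> only the second sum is present; its end term
        \<open>0 ^ n\<close> vanishes because \<open>n \<ge> 1\<close>.\<close>
      using step.hyps by (cases "m = 0") (auto simp: G_def left_diff_distrib of_nat_diff)
  qed
  moreover have "ascent_gf (n + 1) v = (\<Sum>u\<in>{1..n}. (if u < v then fps_X else 1) * ascent_gf n u)"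
    using step.hyps step.prems by (intro ascent_gf_Suc) auto
  moreover have "\<dots> = (1 - fps_X) ^ n * (\<Sum>u\<in>{1..n}. (if u < v then fps_X else 1) * G n u)"
    unfolding sum_distrib_left using step.IH by (intro sum.cong) (auto simp: G_def)
  ultimately have "ascent_gf (n + 1) v = (1 - fps_X) ^ n * ((1 - fps_X) * G (n + 1) v)"
    by simp
  then show ?case by (simp add: G_def mult.assoc)
qed

section \<open>Power sums and Fermat quotients\<close>

lemma cong_power_add_multiple:
  fixes x t :: int
  shows "[(x + int p * t) ^ n = x ^ n + int n * int p * t * x ^ (n - 1)] (mod int p ^ 2)"
proof (induction n)
  case (Suc n)
  show ?case
  proof (cases n)
    case [simp]: (Suc m)
    have "[(x + int p * t) ^ Suc n =
            (x + int p * t) * (x ^ n + int n * int p * t * x ^ (n - 1))] (mod int p ^ 2)"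
      unfolding power_Suc by (intro cong_mult cong_refl Suc.IH)
    also have "(x + int p * t) * (x ^ n + int n * int p * t * x ^ (n - 1)) =
        (x ^ Suc n + int (Suc n) * int p * t * x ^ n) + int p ^ 2 * (t ^ 2 * int n * x ^ m)"
      by (simp add: algebra_simps power2_eq_square)
    also have "[\<dots> = x ^ Suc n + int (Suc n) * int p * t * x ^ n] (mod int p ^ 2)"
      by (simp add: cong_iff_dvd_diff)
    finally show ?thesis by simp
  qed simp
qed simp

lemma fermat_theorem_int:
  assumes "prime p" and "\<not> p dvd a"
  shows "[int a ^ (p - 1) = 1] (mod int p)"
  using fermat_theorem[OF assms] cong_int_iff[of "a ^ (p - 1)" 1 p] by simp

text \<open>
  The combination is chosen so that, modulo \<open>p\<^sup>2\<close>, its values at units depend only on the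
  argument modulo \<open>p\<close>: its derivative is \<open>k (k - 1) x\<^bsup>k - 1\<^esup> (x\<^bsup>p - 1\<^esup> - 1)\<close> modulo \<open>p\<close>.
\<close>
definition unit_power :: "nat \<Rightarrow> nat \<Rightarrow> nat \<Rightarrow> int" where
  "unit_power p k x = int k * int x ^ (k + p - 1) - (int k - 1) * int x ^ k"

text \<open>For \<open>x = y + p t\<close>, expanding both powers to first order leaves the
  correction \<open>p t k y ^ (k - 1) (p y ^ (p - 1) + (k - 1) (y ^ (p - 1) - 1))\<close>; Fermat's
  theorem supplies its second factor \<open>p\<close>.\<close>

lemma unit_power_mod:
  assumes p: "prime p" and k: "k \<ge> 1" and x: "\<not> p dvd x"
  shows "[unit_power p k x = unit_power p k (x mod p)] (mod int p ^ 2)"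
proof -
  define y where "y = x mod p"
  define t where "t = int (x div p)"
  have xy: "int x = int y + int p * t"
    unfolding y_def t_def by (metis add.commute mult_div_mod_eq of_nat_add of_nat_mult)
  have y: "\<not> p dvd y" using x by (simp add: y_def dvd_mod_iff)
  obtain j where j: "k = Suc j" using k by (cases k) auto
  obtain q where q: "p = Suc q" using prime_gt_0_nat[OF p] by (cases p) auto
  have "[unit_power p k x =
     int k * (int y ^ (k + p - 1) + int (k + p - 1) * int p * t * int y ^ (k + p - 1 - 1)) -
     (int k - 1) * (int y ^ k + int k * int p * t * int y ^ (k - 1))] (mod int p ^ 2)"
    unfolding unit_power_def xy by (intro cong_diff cong_mult cong_refl cong_power_add_multiple)
  also have "int k * (int y ^ (k + p - 1) + int (k + p - 1) * int p * t * int y ^ (k + p - 1 - 1)) -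
     (int k - 1) * (int y ^ k + int k * int p * t * int y ^ (k - 1)) =
     unit_power p k y +
       int p * (int k * t * int y ^ j * (int p * int y ^ q + int j * (int y ^ (p - 1) - 1)))"
    by (simp add: unit_power_def j q algebra_simps power_add)
  also have "[\<dots> = unit_power p k y + 0] (mod int p ^ 2)"
  proof (intro cong_add cong_refl)
    have "int p dvd int y ^ (p - 1) - 1"
      using fermat_theorem_int[OF p y] by (simp add: cong_iff_dvd_diff)
    then have "int p dvd int k * t * int y ^ j * (int p * int y ^ q + int j * (int y ^ (p - 1) - 1))"
      by simp
    then show "[int p * (int k * t * int y ^ j *
        (int p * int y ^ q + int j * (int y ^ (p - 1) - 1))) = 0] (mod int p ^ 2)"
      by (simp only: cong_0_iff power2_eq_square mult_dvd_mono dvd_refl)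
  qed
  finally show ?thesis by (simp add: y_def)
qed

lemma bij_betw_mult_mod_prime:
  fixes p c :: nat
  assumes p: "prime p" and c: "\<not> p dvd c"
  shows "bij_betw (\<lambda>a. c * a mod p) {1..<p} {1..<p}"
proof -
  have cop: "coprime c p" using prime_imp_coprime[OF p c] by (simp add: coprime_commute)
  have inj: "inj_on (\<lambda>a. c * a mod p) {1..<p}"
  proof (rule inj_onI)
    fix a b assume ab: "a \<in> {1..<p}" "b \<in> {1..<p}" and "c * a mod p = c * b mod p"
    then have "[a = b] (mod p)"
      using cong_mult_lcancel_nat[OF cop, of a b] by (simp add: cong_def)
    then show "a = b" using ab by (simp add: cong_def)
  qed
  have "(\<lambda>a. c * a mod p) ` {1..<p} \<subseteq> {1..<p}"
  proof clarify
    fix a assume a: "a \<in> {1..<p}"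
    then have "\<not> p dvd c * a"
      using p c by (auto simp: prime_dvd_mult_iff dest: dvd_imp_le)
    then have "c * a mod p \<noteq> 0" by (simp add: dvd_eq_mod_eq_0)
    then show "c * a mod p \<in> {1..<p}"
      using prime_gt_0_nat[OF p] by simp
  qed
  with inj show ?thesis
    by (simp add: bij_betw_def endo_inj_surj)
qed

text \<open>The witness is the \<open>p\<close>-th power of a primitive root modulo \<open>p\<close>.\<close>
lemma exists_root_of_unity_mod_square:
  assumes p: "prime p"
  obtains c where "\<not> p dvd c" and "[c ^ (p - 1) = 1] (mod p ^ 2)"
    and "\<And>k. [c ^ k = 1] (mod p) \<Longrightarrow> p - 1 dvd k"
proof -
  obtain g where g: "residue_primroot p g" using prime_primitive_root_exists[OF prime_gt_1_nat[OF p] p] by blast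
  then have cop: "coprime p g" and ord: "ord p g = p - 1"
    using p by (auto simp: residue_primroot_def totient_prime)
  have pg: "\<not> p dvd g" using cop p by (metis coprime_absorb_left not_prime_unit)
  show thesis
  proof
    show "\<not> p dvd g ^ p" using pg p prime_dvd_power by blast
    have "[g ^ totient (p ^ 2) = 1] (mod p ^ 2)"
      using cop by (intro euler_theorem) (simp add: coprime_commute)
    then show "[(g ^ p) ^ (p - 1) = 1] (mod p ^ 2)"
      using p by (simp add: totient_prime_power power_mult)
    show "p - 1 dvd k" if "[(g ^ p) ^ k = 1] (mod p)" for k
    proof -
      \<comment> \<open>Raising \<open>g\<close> to the power \<open>p\<close> keeps its order
        modulo \<open>p\<close>, as \<open>p\<close> is prime to \<open>p - 1\<close>.\<close>
      have "p - 1 dvd p * k"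
        using that ord by (simp add: power_mult [symmetric] ord_divides')
      moreover have "coprime (p - 1) p"
        using prime_gt_0_nat[OF p] by (cases p) (auto simp: coprime_Suc_right_nat)
      ultimately show ?thesis by (simp add: coprime_dvd_mult_right_iff)
    qed
  qed
qed

text \<open>Let \<open>G\<close> be the sum of \<open>unit_power p k\<close> over the nonzero
  residues. Multiplication by the root of unity \<open>c\<close> permutes these residues and scales
  each summand by \<open>c ^ k\<close>, so \<open>(c ^ k - 1) * G\<close> vanishes modulo
  \<open>p ^ 2\<close>. As \<open>p - 1\<close> does not divide \<open>k\<close>, the first factor
  is a unit and \<open>G\<close> itself vanishes.\<close>

lemma kummer_power_sums:
  assumes p: "prime p" and k: "1 \<le> k" "k \<le> p - 2"
  shows "[int k * (\<Sum>a\<in>{1..<p}. int a ^ (k + p - 1)) =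
           (int k - 1) * (\<Sum>a\<in>{1..<p}. int a ^ k)] (mod int p ^ 2)"
proof -
  obtain c where c: "\<not> p dvd c" "[c ^ (p - 1) = 1] (mod p ^ 2)"
    and ord: "\<And>k. [c ^ k = 1] (mod p) \<Longrightarrow> p - 1 dvd k"
    by (rule exists_root_of_unity_mod_square[OF p]) blast
  define G where "G = (\<Sum>a\<in>{1..<p}. unit_power p k a)"
  have c1: "[int c ^ (p - 1) = 1] (mod int p ^ 2)"
    using c(2) cong_int_iff[of "c ^ (p - 1)" 1 "p ^ 2"] by simp
  have hom: "[unit_power p k (c * a mod p) = int c ^ k * unit_power p k a] (mod int p ^ 2)"
    if a: "a \<in> {1..<p}" for a
  proof -
    have "\<not> p dvd c * a"
      using p c(1) a by (auto simp: prime_dvd_mult_iff dest: dvd_imp_le)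
    then have "[unit_power p k (c * a mod p) = unit_power p k (c * a)] (mod int p ^ 2)"
      using unit_power_mod[OF p k(1)] by (simp add: cong_sym)
    also have "unit_power p k (c * a) = int c ^ k *
        (int k * (int c ^ (p - 1) * int a ^ (k + p - 1)) - (int k - 1) * int a ^ k)"
      using prime_gt_0_nat[OF p]
      by (cases p) (simp_all add: unit_power_def power_mult_distrib power_add algebra_simps)
    also have "[\<dots> = int c ^ k *
        (int k * (1 * int a ^ (k + p - 1)) - (int k - 1) * int a ^ k)] (mod int p ^ 2)"
      by (intro cong_mult cong_diff cong_refl c1)
    finally show ?thesis by (simp add: unit_power_def)
  qed
  have "G = (\<Sum>a\<in>{1..<p}. unit_power p k (c * a mod p))"
    unfolding G_def by (rule sum.reindex_bij_betw[OF bij_betw_mult_mod_prime[OF p c(1)], symmetric])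
  also have "[\<dots> = (\<Sum>a\<in>{1..<p}. int c ^ k * unit_power p k a)] (mod int p ^ 2)"
    by (intro cong_sum hom)
  also have "(\<Sum>a\<in>{1..<p}. int c ^ k * unit_power p k a) = int c ^ k * G"
    by (simp add: G_def sum_distrib_left)
  finally have dvd: "int p ^ 2 dvd (int c ^ k - 1) * G"
    by (simp add: cong_iff_dvd_diff dvd_diff_commute left_diff_distrib)
  have "\<not> p - 1 dvd k" using k by (auto dest: dvd_imp_le)
  then have "\<not> int p dvd int c ^ k - 1"
    using ord[of k] cong_int_iff[of "c ^ k" 1 p] by (auto simp: cong_iff_dvd_diff)
  then have "coprime (int p ^ 2) (int c ^ k - 1)"
    using p by (simp add: prime_imp_coprime)
  with dvd have "int p ^ 2 dvd G" by (simp add: coprime_dvd_mult_right_iff)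
  then show ?thesis
    by (simp add: G_def unit_power_def cong_iff_dvd_diff sum_subtractf sum_distrib_left)
qed

section \<open>Power sums weighted by Fermat quotients\<close>

definition fermat_quotient :: "nat \<Rightarrow> nat \<Rightarrow> int" where
  "fermat_quotient p a = (int a ^ (p - 1) - 1) div int p"

lemma times_fermat_quotient:
  assumes "prime p" and "\<not> p dvd a"
  shows "int p * fermat_quotient p a = int a ^ (p - 1) - 1"
  using fermat_theorem_int[OF assms] by (simp add: fermat_quotient_def cong_iff_dvd_diff)

lemma not_dvd_if_in_range: "a \<in> {1..<p} \<Longrightarrow> \<not> p dvd (a::nat)"
  by (auto dest: dvd_imp_le)

text \<open>Substituting \<open>a ^ (p - 1) - 1\<close> for \<open>p\<close> times the quotient
  turns the weighted sum into the difference of the power sums of exponents \<open>k + p - 1\<close>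
  and \<open>k\<close>; the Kummer-type congruence evaluates \<open>k\<close> times it.\<close>

lemma power_sum_cong_fermat_quotients:
  assumes p: "prime p" and k: "1 \<le> k" "k \<le> p - 2"
  shows "[(\<Sum>a\<in>{1..<p}. int a ^ k) =
           - (int p * (int k * (\<Sum>a\<in>{1..<p}. int a ^ k * fermat_quotient p a)))] (mod int p ^ 2)"
proof -
  have "int p * (\<Sum>a\<in>{1..<p}. int a ^ k * fermat_quotient p a) =
      (\<Sum>a\<in>{1..<p}. int a ^ k * (int a ^ (p - 1) - 1))"
    unfolding sum_distrib_left
    by (intro sum.cong refl, subst mult.left_commute,
        subst times_fermat_quotient[OF p not_dvd_if_in_range]) auto
  also have "\<dots> = (\<Sum>a\<in>{1..<p}. int a ^ (k + p - 1)) - (\<Sum>a\<in>{1..<p}. int a ^ k)"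
    using prime_gt_0_nat[OF p]
    by (cases p) (simp_all add: sum_subtractf algebra_simps power_add)
  finally have "int k * (int p * (\<Sum>a\<in>{1..<p}. int a ^ k * fermat_quotient p a)) =
      int k * ((\<Sum>a\<in>{1..<p}. int a ^ (k + p - 1)) - (\<Sum>a\<in>{1..<p}. int a ^ k))"
    by simp
  then have eq: "int p * (int k * (\<Sum>a\<in>{1..<p}. int a ^ k * fermat_quotient p a)) =
      int k * (\<Sum>a\<in>{1..<p}. int a ^ (k + p - 1)) - int k * (\<Sum>a\<in>{1..<p}. int a ^ k)"
    by (simp only: right_diff_distrib mult.left_commute)
  show ?thesis
    using kummer_power_sums[OF assms] unfolding eq by (simp add: cong_iff_dvd_diff algebra_simps)
qed

text \<open>Here \<open>2 ^ (p - 1 - k)\<close> plays the role of \<open>2 ^ (-k)\<close>. For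
  \<open>a = 2\<close> all \<open>p - 2\<close> terms are \<open>1\<close>. Otherwise
  \<open>a ^ p - 2 ^ p\<close>, congruent to \<open>a - 2\<close>, factors as \<open>a - 2\<close>
  times the sum over \<open>0 \<le> k < p\<close>; that sum is therefore \<open>1\<close>, and its
  two end terms are \<open>1\<close> each.\<close>

lemma geometric_sum_cong:
  assumes p: "prime p" "odd p" and a: "a \<in> {1..<p}"
  shows "[(\<Sum>k=1..p - 2. int a ^ k * 2 ^ (p - 1 - k)) = - 1 - (if a = 2 then 1 else 0)] (mod int p)"
proof -
  have p3: "p \<ge> 3" using p prime_ge_2_nat[of p] by (cases "p = 2") auto
  have F: "[int b ^ (p - 1) = 1] (mod int p)" if "b \<in> {1..<p}" for b
    using fermat_theorem_int[OF p(1) not_dvd_if_in_range[OF that]] .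
  have F2: "[2 ^ (p - 1) = 1] (mod int p)" using F[of 2] p3 by simp
  show ?thesis
  proof (cases "a = 2")
    case True
    have "(\<Sum>k=1..p - 2. int a ^ k * 2 ^ (p - 1 - k)) = (\<Sum>k=1..p - 2. 2 ^ (p - 1))"
      using True by (intro sum.cong) (auto simp flip: power_add)
    also have "\<dots> = int (p - 2) * 2 ^ (p - 1)" by simp
    also have "[\<dots> = int (p - 2) * 1] (mod int p)" by (intro cong_mult cong_refl F2)
    also have "[int (p - 2) * 1 = - 2] (mod int p)"
      using p3 by (simp add: cong_iff_dvd_diff of_nat_diff)
    finally show ?thesis using True by simp
  next
    case False
    define s where "s = (\<Sum>k=1..p - 2. int a ^ k * 2 ^ (p - 1 - k))"
    have split: "{..<p} = insert 0 (insert (p - 1) {1..p - 2})" "p - 1 \<notin> {1..p - 2}"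
      using p3 by auto
    have "(\<Sum>k<p. 2 ^ (p - Suc k) * int a ^ k) =
        2 ^ (p - 1) + (int a ^ (p - 1) + s)"
      unfolding split(1) s_def using p3 split(2) by (simp add: mult.commute)
    then have eq: "int a ^ p - 2 ^ p = (int a - 2) * (2 ^ (p - 1) + (int a ^ (p - 1) + s))"
      by (simp add: power_diff_sumr2)
    have "[int a * int a ^ (p - 1) - 2 * 2 ^ (p - 1) = int a * 1 - 2 * 1] (mod int p)"
      by (intro cong_diff cong_mult cong_refl F2 F[OF a])
    moreover have "int a ^ p = int a * int a ^ (p - 1)" "(2::int) ^ p = 2 * 2 ^ (p - 1)"
      using p3 by (simp_all flip: power_Suc)
    ultimately have "[(int a - 2) * (2 ^ (p - 1) + (int a ^ (p - 1) + s)) = (int a - 2) * 1] (mod int p)"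
      unfolding eq [symmetric] by simp
    moreover have "\<not> int p dvd int a - 2"
    proof
      assume "int p dvd int a - 2"
      then have "[a = 2] (mod p)" using cong_int_iff[of a 2 p] by (simp add: cong_iff_dvd_diff)
      then show False using False a p3 by (simp add: cong_def)
    qed
    then have "coprime (int a - 2) (int p)"
      using p by (simp add: prime_imp_coprime coprime_commute)
    ultimately have "[2 ^ (p - 1) + (int a ^ (p - 1) + s) = 1] (mod int p)"
      using cong_mult_lcancel by blast
    moreover have "[2 ^ (p - 1) + (int a ^ (p - 1) + s) = 1 + (1 + s)] (mod int p)"
      by (intro cong_add F2 F[OF a] cong_refl)
    ultimately have "[1 + (1 + s) = 1] (mod int p)" using cong_sym cong_trans by blast
    then show ?thesis using False by (simp add: s_def cong_iff_dvd_diff algebra_simps)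
  qed
qed

text \<open>With the sums exchanged, the inner geometric sum gives each \<open>a\<close> weight
  \<open>1\<close>, and \<open>a = 2\<close> weight \<open>2\<close>.\<close>

lemma sum_fermat_quotients_cong:
  assumes p: "prime p" "odd p"
  shows "[(\<Sum>k=1..p - 2. - (\<Sum>a\<in>{1..<p}. int a ^ k * fermat_quotient p a) * 2 ^ (p - 1 - k)) =
           (\<Sum>a\<in>{1..<p}. fermat_quotient p a) + fermat_quotient p 2] (mod int p)"
proof -
  have p3: "p \<ge> 3" using p prime_ge_2_nat[of p] by (cases "p = 2") auto
  have "(\<Sum>k=1..p - 2. - (\<Sum>a\<in>{1..<p}. int a ^ k * fermat_quotient p a) * 2 ^ (p - 1 - k)) =
      (\<Sum>k=1..p - 2. \<Sum>a\<in>{1..<p}. - fermat_quotient p a * (int a ^ k * 2 ^ (p - 1 - k)))"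
    by (simp add: sum_distrib_left sum_distrib_right sum_negf mult_ac)
  also have "\<dots> = (\<Sum>a\<in>{1..<p}. - fermat_quotient p a *
                   (\<Sum>k=1..p - 2. int a ^ k * 2 ^ (p - 1 - k)))"
    unfolding sum_distrib_left by (rule sum.swap)
  also have "[\<dots> = (\<Sum>a\<in>{1..<p}. - fermat_quotient p a * (- 1 - (if a = 2 then 1 else 0)))] (mod int p)"
    by (intro cong_sum cong_mult cong_refl geometric_sum_cong p)
  also have "(\<Sum>a\<in>{1..<p}. - fermat_quotient p a * (- 1 - (if a = 2 then 1 else 0))) =
      (\<Sum>a\<in>{1..<p}. fermat_quotient p a + (if a = 2 then fermat_quotient p 2 else 0))"
    by (intro sum.cong) auto
  also have "\<dots> = (\<Sum>a\<in>{1..<p}. fermat_quotient p a) + fermat_quotient p 2"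
    using p3 by (simp add: sum.distrib)
  finally show ?thesis .
qed

section \<open>Bernoulli numbers as rational p-adic integers\<close>

lemma rat_padic_ints_of_int:
  assumes "prime p" shows "of_int a \<in> rat_padic_ints p"
proof -
  have "of_int a = (of_int a / of_int 1 :: rat)" by simp
  moreover have "\<not> int p dvd 1" using prime_gt_1_nat[OF assms] by simp
  ultimately show ?thesis unfolding rat_padic_ints_def by blast
qed

lemma rat_padic_ints_of_nat: "prime p \<Longrightarrow> of_nat a \<in> rat_padic_ints p"
  using rat_padic_ints_of_int[of p "int a"] by simp

lemma rat_padic_ints_inverse_of_nat:
  assumes "\<not> p dvd b" shows "inverse (of_nat b) \<in> rat_padic_ints p"
proof -
  have "inverse (of_nat b) = (of_int 1 / of_int (int b) :: rat)" by (simp add: divide_inverse)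
  moreover have "\<not> int p dvd int b" using assms by simp
  ultimately show ?thesis unfolding rat_padic_ints_def by blast
qed

lemma rat_padic_ints_add:
  assumes p: "prime p" and "x \<in> rat_padic_ints p" "y \<in> rat_padic_ints p"
  shows "x + y \<in> rat_padic_ints p"
proof -
  obtain a b c d where x: "x = of_int a / of_int b" "\<not> int p dvd b"
    and y: "y = of_int c / of_int d" "\<not> int p dvd d"
    using assms by (auto simp: rat_padic_ints_def)
  have "b \<noteq> 0" "d \<noteq> 0" using x y by auto
  then have "x + y = of_int (a * d + c * b) / of_int (b * d)"
    by (simp add: x y field_simps)
  moreover have "\<not> int p dvd b * d" using p x y by (simp add: prime_dvd_mult_iff)
  ultimately show ?thesis unfolding rat_padic_ints_def by blast
qed

lemma rat_padic_ints_mult: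
  assumes p: "prime p" and "x \<in> rat_padic_ints p" "y \<in> rat_padic_ints p"
  shows "x * y \<in> rat_padic_ints p"
proof -
  obtain a b c d where x: "x = of_int a / of_int b" "\<not> int p dvd b"
    and y: "y = of_int c / of_int d" "\<not> int p dvd d"
    using assms by (auto simp: rat_padic_ints_def)
  have "x * y = of_int (a * c) / of_int (b * d)"
    by (simp add: x y)
  moreover have "\<not> int p dvd b * d" using p x y by (simp add: prime_dvd_mult_iff)
  ultimately show ?thesis unfolding rat_padic_ints_def by blast
qed

lemma rat_padic_ints_uminus:
  assumes p: "prime p" and "x \<in> rat_padic_ints p"
  shows "- x \<in> rat_padic_ints p"
  using rat_padic_ints_mult[OF p rat_padic_ints_of_int[OF p, of "- 1"] assms(2)] by simp

lemma rat_padic_ints_sum: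
  assumes p: "prime p" and "\<And>i. i \<in> A \<Longrightarrow> f i \<in> rat_padic_ints p"
  shows "sum f A \<in> rat_padic_ints p"
  using assms(2)
proof (induction A rule: infinite_finite_induct)
  case (insert i A)
  then show ?case by (simp add: rat_padic_ints_add[OF p])
qed (use rat_padic_ints_of_int[OF p, of 0] in simp_all)

lemma padic_cong_sym:
  assumes p: "prime p" and "padic_cong p r x y" shows "padic_cong p r y x"
proof -
  obtain u where u: "u \<in> rat_padic_ints p" "x - y = of_nat p ^ r * u"
    using assms by (auto simp: padic_cong_def)
  then have "y - x = of_nat p ^ r * (- u)" by (simp add: algebra_simps)
  then show ?thesis using rat_padic_ints_uminus[OF p u(1)] unfolding padic_cong_def by blast
qed

lemma padic_cong_add:
  assumes p: "prime p" and "padic_cong p r x y" "padic_cong p r z w"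
  shows "padic_cong p r (x + z) (y + w)"
proof -
  obtain u v where u: "u \<in> rat_padic_ints p" "x - y = of_nat p ^ r * u"
    and v: "v \<in> rat_padic_ints p" "z - w = of_nat p ^ r * v"
    using assms by (auto simp: padic_cong_def)
  then have "(x + z) - (y + w) = of_nat p ^ r * (u + v)" by (simp add: algebra_simps)
  then show ?thesis using rat_padic_ints_add[OF p u(1) v(1)] unfolding padic_cong_def by blast
qed

lemma padic_cong_refl: "prime p \<Longrightarrow> padic_cong p r x x"
  using rat_padic_ints_of_int[of p 0] by (force simp: padic_cong_def)

lemma padic_cong_trans:
  assumes "prime p" and "padic_cong p r x y" "padic_cong p r y z"
  shows "padic_cong p r x z"
  using padic_cong_add[OF assms] by (simp add: padic_cong_def)

lemma padic_cong_sum: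
  assumes p: "prime p" and "\<And>i. i \<in> A \<Longrightarrow> padic_cong p r (f i) (g i)"
  shows "padic_cong p r (sum f A) (sum g A)"
  using assms(2)
  by (induction A rule: infinite_finite_induct)
     (auto intro: padic_cong_add padic_cong_refl p)

lemma padic_cong_mult_left:
  assumes p: "prime p" and "c \<in> rat_padic_ints p" "padic_cong p r x y"
  shows "padic_cong p r (c * x) (c * y)"
proof -
  obtain u where u: "u \<in> rat_padic_ints p" "x - y = of_nat p ^ r * u"
    using assms by (auto simp: padic_cong_def)
  then have "c * x - c * y = of_nat p ^ r * (c * u)" by (simp flip: right_diff_distrib)
  then show ?thesis
    using rat_padic_ints_mult[OF p assms(2) u(1)] unfolding padic_cong_def by blast
qed

lemma padic_cong_of_int:
  assumes p: "prime p" and "[a = b] (mod int p ^ r)"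
  shows "padic_cong p r (of_int a) (of_int b)"
proof -
  obtain k where "a - b = int p ^ r * k" using assms by (auto simp: cong_iff_dvd_diff)
  then have "of_int a - of_int b = (of_nat p ^ r * of_int k :: rat)"
    by (metis of_int_diff of_int_mult of_int_of_nat_eq of_int_power)
  then show ?thesis using rat_padic_ints_of_int[OF p] unfolding padic_cong_def by blast
qed

text \<open>Division by \<open>p\<close> costs one power of \<open>p\<close>, hence the earlier work
  modulo \<open>p ^ 2\<close>.\<close>

lemma padic_cong_divide_prime:
  assumes p: "prime p" and "padic_cong p (Suc r) x y"
  shows "padic_cong p r (x / of_nat p) (y / of_nat p)"
proof -
  obtain u where "u \<in> rat_padic_ints p" "x - y = of_nat p ^ Suc r * u"
    using assms by (auto simp: padic_cong_def)
  moreover have "of_nat p \<noteq> (0::rat)" using prime_gt_0_nat[OF p] by simp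
  ultimately show ?thesis
    by (auto simp: padic_cong_def simp flip: diff_divide_distrib)
qed

section \<open>Faulhaber's formula and its reduction modulo \<open>p ^ 2\<close>\<close>

lemma bernoulli_gf:
  "(fps_X / (fps_exp 1 - 1)) * (fps_exp 1 - 1) = (fps_X :: rat fps)"
proof -
  have "subdegree (fps_exp 1 - 1 :: rat fps) = 1" by (rule subdegreeI) auto
  then have "(fps_exp 1 - 1 :: rat fps) dvd fps_X"
    by (subst fps_dvd_iff) auto
  then show ?thesis by simp
qed

text \<open>Faulhaber's formula: compare coefficients in
  \<open>b * (exp (N X) - 1) = X * (\<Sum>a<N. exp (a X))\<close>, where \<open>b\<close> is the
  Bernoulli series.\<close>

lemma sum_powers_bernoulli:
  "(\<Sum>a<N. of_nat a ^ m) =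
     (\<Sum>i\<le>m. of_nat (m choose i) * bernoulli i * (of_nat N ^ (m + 1 - i) / of_nat (m + 1 - i)))"
proof -
  define b where "b = (fps_X / (fps_exp 1 - 1) :: rat fps)"
  have "(fps_exp 1 - 1 :: rat fps) * (\<Sum>a<N. fps_exp 1 ^ a) = fps_exp (of_nat N) - 1"
    using power_diff_1_eq[of "fps_exp 1 :: rat fps" N] by (simp add: fps_exp_power_mult)
  then have "b * (fps_exp (of_nat N) - 1) = b * (fps_exp 1 - 1) * (\<Sum>a<N. fps_exp 1 ^ a)"
    by (simp add: mult.assoc)
  also have "\<dots> = fps_X * (\<Sum>a<N. fps_exp (of_nat a))"
    by (simp add: b_def bernoulli_gf fps_exp_power_mult)
  finally have "fps_nth (b * (fps_exp (of_nat N) - 1)) (Suc m) =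
      fps_nth (fps_X * (\<Sum>a<N. fps_exp (of_nat a))) (Suc m)"
    by simp
  also have "\<dots> = (\<Sum>a<N. of_nat a ^ m) / fact m"
    by (simp add: fps_sum_nth sum_divide_distrib)
  \<comment> \<open>The index \<open>i = Suc m\<close> drops out because the second factor has no
    constant term.\<close>
  also have "fps_nth (b * (fps_exp (of_nat N) - 1)) (Suc m) =
      (\<Sum>i\<le>m. fps_nth b i * (of_nat N ^ (m + 1 - i) / fact (m + 1 - i)))"
    by (simp add: fps_mult_nth atLeast0AtMost)
  finally have "(\<Sum>a<N. of_nat a ^ m) =
      fact m * (\<Sum>i\<le>m. fps_nth b i * (of_nat N ^ (m + 1 - i) / fact (m + 1 - i)))"
    by (simp add: field_simps)
  also have "\<dots> = (\<Sum>i\<le>m. of_nat (m choose i) * bernoulli i *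
                     (of_nat N ^ (m + 1 - i) / of_nat (m + 1 - i)))"
    unfolding sum_distrib_left
  proof (intro sum.cong refl)
    fix i assume "i \<in> {..m}"
    then have i: "i \<le> m" by simp
    then have "fact (m + 1 - i) = (of_nat (m + 1 - i) * fact (m - i) :: rat)"
      by (simp add: Suc_diff_le)
    then show "fact m * (fps_nth b i * (of_nat N ^ (m + 1 - i) / fact (m + 1 - i))) =
        of_nat (m choose i) * bernoulli i * (of_nat N ^ (m + 1 - i) / of_nat (m + 1 - i))"
      using binomial_fact[OF i, where 'a = rat] i
      by (simp add: bernoulli_def b_def mult_ac)
  qed
  finally show ?thesis .
qed

text \<open>Faulhaber's formula at \<open>N = 1\<close> is a recursion for
  \<open>bernoulli m\<close> whose denominators are at most \<open>m + 1 < p\<close>.\<close>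

lemma bernoulli_padic_int:
  assumes p: "prime p" and "m \<le> p - 2"
  shows "bernoulli m \<in> rat_padic_ints p"
  using assms(2)
proof (induction m rule: less_induct)
  case (less m)
  show ?case
  proof (cases "m = 0")
    case True
    have "bernoulli 0 = 1" using sum_powers_bernoulli[of 0 1] by simp
    then show ?thesis using True rat_padic_ints_of_int[OF p, of 1] by simp
  next
    case False
    have "{..m} = insert m {..<m}" by auto
    then have "bernoulli m +
        (\<Sum>i<m. of_nat (m choose i) * bernoulli i * inverse (of_nat (m + 1 - i))) = 0 ^ m"
      using sum_powers_bernoulli[of m 1] by (simp add: inverse_eq_divide)
    also have "\<dots> = 0" using False by simp
    finally have "bernoulli m =
        - (\<Sum>i<m. of_nat (m choose i) * bernoulli i * inverse (of_nat (m + 1 - i)))"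
      by (simp only: eq_neg_iff_add_eq_0)
    moreover have "(\<Sum>i<m. of_nat (m choose i) * bernoulli i * inverse (of_nat (m + 1 - i)))
        \<in> rat_padic_ints p"
    proof (intro rat_padic_ints_sum rat_padic_ints_mult rat_padic_ints_of_nat
        rat_padic_ints_inverse_of_nat p)
      fix i assume i: "i \<in> {..<m}"
      then show "bernoulli i \<in> rat_padic_ints p" using less by auto
      show "\<not> p dvd m + 1 - i" using i less.prems by (auto dest: dvd_imp_le)
    qed
    ultimately show ?thesis using rat_padic_ints_uminus[OF p] by simp
  qed
qed

text \<open>The top term of Faulhaber's formula is \<open>p\<close> times
  \<open>bernoulli m\<close>. Each other term is \<open>p ^ 2\<close> times a p-adic integer: the
  Bernoulli numbers involved have index at most \<open>p - 2\<close>, and the only denominator that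
  \<open>p\<close> can divide is \<open>p\<close> itself.\<close>

lemma power_sum_cong_bernoulli:
  assumes p: "prime p" "odd p" and m: "1 \<le> m" "m \<le> p - 1"
  shows "padic_cong p 2 (of_int (\<Sum>a\<in>{1..<p}. int a ^ m)) (of_nat p * bernoulli m)"
proof -
  have p3: "p \<ge> 3" using p prime_ge_2_nat[of p] by (cases "p = 2") auto
  have "{..<p} = insert 0 {1..<p}" using p3 by auto
  then have "of_int (\<Sum>a\<in>{1..<p}. int a ^ m) = (\<Sum>a<p. of_nat a ^ m :: rat)"
    using m by simp
  also have "\<dots> = of_nat p * bernoulli m +
      (\<Sum>i<m. of_nat (m choose i) * bernoulli i * (of_nat p ^ (m + 1 - i) / of_nat (m + 1 - i)))"
    unfolding sum_powers_bernoulli by (simp add: lessThan_Suc_atMost [symmetric])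
  also have "(\<Sum>i<m. of_nat (m choose i) * bernoulli i * (of_nat p ^ (m + 1 - i) / of_nat (m + 1 - i))) =
      of_nat p ^ 2 * (\<Sum>i<m. of_nat (m choose i) * bernoulli i *
        (of_nat p ^ (m - 1 - i) / of_nat (m + 1 - i)))"
    unfolding sum_distrib_left
  proof (intro sum.cong refl)
    fix i assume "i \<in> {..<m}"
    then have "m + 1 - i = 2 + (m - 1 - i)" by auto
    then have "(of_nat p :: rat) ^ (m + 1 - i) = of_nat p ^ 2 * of_nat p ^ (m - 1 - i)"
      by (metis power_add)
    then show "of_nat (m choose i) * bernoulli i * (of_nat p ^ (m + 1 - i) / of_nat (m + 1 - i)) =
        of_nat p ^ 2 * (of_nat (m choose i) * bernoulli i *
          (of_nat p ^ (m - 1 - i) / of_nat (m + 1 - i)))"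
      by (simp add: mult_ac)
  qed
  finally have "of_int (\<Sum>a\<in>{1..<p}. int a ^ m) - of_nat p * bernoulli m =
      of_nat p ^ 2 * (\<Sum>i<m. of_nat (m choose i) * bernoulli i *
        (of_nat p ^ (m - 1 - i) / of_nat (m + 1 - i)))"
    by simp
  moreover have "(\<Sum>i<m. of_nat (m choose i) * bernoulli i *
        (of_nat p ^ (m - 1 - i) / of_nat (m + 1 - i))) \<in> rat_padic_ints p"
  proof (intro rat_padic_ints_sum rat_padic_ints_mult rat_padic_ints_of_nat bernoulli_padic_int p)
    fix i assume "i \<in> {..<m}"
    then have i: "i < m" by simp
    then show "i \<le> p - 2" using m by linarith
    show "of_nat p ^ (m - 1 - i) / of_nat (m + 1 - i) \<in> rat_padic_ints p"
    proof (cases "m + 1 - i = p")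
      case True
      \<comment> \<open>This is the term \<open>m = p - 1\<close>, \<open>i = 0\<close>; as
        \<open>p \<ge> 3\<close>, the numerator still contains a factor \<open>p\<close> to cancel
        the denominator.\<close>
      then have "m - 1 - i = Suc (p - 3)" using p3 by linarith
      then have "of_nat p ^ (m - 1 - i) / of_nat (m + 1 - i) = (of_nat (p ^ (p - 3)) :: rat)"
        using True p3 by simp
      then show ?thesis using rat_padic_ints_of_nat[OF p(1)] by metis
    next
      case False
      then have "\<not> p dvd m + 1 - i" using m i by (auto dest!: dvd_imp_le)
      then have "of_nat (p ^ (m - 1 - i)) * inverse (of_nat (m + 1 - i)) \<in> rat_padic_ints p"
        by (intro rat_padic_ints_mult rat_padic_ints_of_nat rat_padic_ints_inverse_of_nat p)
      then show ?thesis by (simp add: divide_inverse)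
    qed
  qed
  ultimately show ?thesis unfolding padic_cong_def by blast
qed

section \<open>Bernoulli quotients as sums of Fermat quotients\<close>

text \<open>Two evaluations of one power sum modulo \<open>p ^ 2\<close> are compared, then divided
  by \<open>p\<close> and by the unit \<open>k * 2 ^ k\<close>. Multiplying by
  \<open>2 ^ (p - 1)\<close>, which is \<open>1\<close> modulo \<open>p\<close>, makes the
  right-hand side an integer.\<close>

lemma divided_bernoulli_cong:
  assumes p: "prime p" "odd p" and k: "1 \<le> k" "k \<le> p - 2"
  shows "padic_cong p 1 (divided_bernoulli k / 2 ^ k)
    (of_int (- (\<Sum>a\<in>{1..<p}. int a ^ k * fermat_quotient p a) * 2 ^ (p - 1 - k)))"
proof -
  define T where "T = (\<Sum>a\<in>{1..<p}. int a ^ k * fermat_quotient p a)"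
  have p0: "(of_nat p :: rat) \<noteq> 0" using prime_gt_0_nat[OF p(1)] by simp
  have "padic_cong p 2 (of_nat p * bernoulli k) (of_int (- (int p * (int k * T))))"
    unfolding T_def
    using k by (intro padic_cong_trans[OF p(1) padic_cong_sym[OF p(1) power_sum_cong_bernoulli]]
        padic_cong_of_int power_sum_cong_fermat_quotients p) auto
  then have "padic_cong p (Suc 1) (of_nat p * bernoulli k) (of_int (- (int p * (int k * T))))"
    by (simp add: numeral_2_eq_2)
  from padic_cong_divide_prime[OF p(1) this] p0
  have B: "padic_cong p 1 (bernoulli k) (of_int (- (int k * T)))"
    by simp
  have two: "\<not> p dvd 2" using p primes_dvd_imp_eq[of p 2] by auto
  then have "\<not> p dvd k" "\<not> p dvd 2 ^ k"
    using p k prime_dvd_power by (auto dest: dvd_imp_le)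
  then have "\<not> p dvd k * 2 ^ k"
    using p by (simp add: prime_dvd_mult_iff)
  note unit = rat_padic_ints_inverse_of_nat[OF this]
  have 1: "padic_cong p 1 (divided_bernoulli k / 2 ^ k) (of_int (- T) / 2 ^ k)"
  proof -
    have cancel: "inverse (x * y) * (- (x * t)) = - t / y" if "x \<noteq> 0" for x y t :: rat
      using that by (cases "y = 0") (simp_all add: field_simps)
    have "inverse (of_nat (k * 2 ^ k)) * bernoulli k = divided_bernoulli k / 2 ^ k"
      by (simp add: divided_bernoulli_def divide_inverse mult_ac)
    moreover have "inverse (of_nat (k * 2 ^ k)) * of_int (- (int k * T)) =
        of_int (- T) / (2 ^ k :: rat)"
      using cancel[of "of_nat k" "2 ^ k" "of_int T"] k by simp
    ultimately show ?thesis using padic_cong_mult_left[OF p(1) unit B] by simp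
  qed
  have "\<not> p dvd 2 ^ k" using \<open>\<not> p dvd k * 2 ^ k\<close> by auto
  then have unit2: "inverse (of_nat (2 ^ k)) \<in> rat_padic_ints p"
    by (rule rat_padic_ints_inverse_of_nat)
  have "[- T * 1 = - T * int 2 ^ (p - 1)] (mod int p ^ 1)"
    unfolding power_one_right
    by (intro cong_mult cong_refl cong_sym[OF fermat_theorem_int] p two)
  from padic_cong_mult_left[OF p(1) unit2 padic_cong_of_int[OF p(1) this]]
  have "padic_cong p 1 (of_int (- T) / 2 ^ k) (of_int (- T) * (2 ^ (p - 1) / 2 ^ k))"
    by (simp add: divide_inverse mult_ac)
  also have "(2::rat) ^ (p - 1) / 2 ^ k = 2 ^ (p - 1 - k)"
    using k by (simp add: power_diff)
  finally show ?thesis using padic_cong_trans[OF p(1) 1] by (simp add: T_def)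
qed

lemma agoh_giuga_cong:
  assumes p: "prime p" "odd p"
  shows "padic_cong p 1 ((of_nat p * bernoulli (p - 1) + 1) / of_nat p)
           (of_int (1 + (\<Sum>a\<in>{1..<p}. fermat_quotient p a)))"
proof -
  have p3: "p \<ge> 3" using p prime_ge_2_nat[of p] by (cases "p = 2") auto
  have "(\<Sum>a\<in>{1..<p}. int a ^ (p - 1)) = (\<Sum>a\<in>{1..<p}. 1 + int p * fermat_quotient p a)"
    by (intro sum.cong refl, subst times_fermat_quotient[OF p(1) not_dvd_if_in_range]) auto
  also have "\<dots> = int p - 1 + int p * (\<Sum>a\<in>{1..<p}. fermat_quotient p a)"
    using p3 by (simp add: sum.distrib sum_distrib_left of_nat_diff)
  finally have S: "(\<Sum>a\<in>{1..<p}. int a ^ (p - 1)) + 1 =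
      int p * (1 + (\<Sum>a\<in>{1..<p}. fermat_quotient p a))"
    by (simp add: algebra_simps)
  have "padic_cong p 2 (of_nat p * bernoulli (p - 1)) (of_int (\<Sum>a\<in>{1..<p}. int a ^ (p - 1)))"
    using p3 by (intro padic_cong_sym[OF p(1) power_sum_cong_bernoulli[OF p]]) auto
  then have "padic_cong p 2 (of_nat p * bernoulli (p - 1) + 1)
      (of_int (\<Sum>a\<in>{1..<p}. int a ^ (p - 1)) + 1)"
    by (intro padic_cong_add padic_cong_refl p)
  also have "of_int (\<Sum>a\<in>{1..<p}. int a ^ (p - 1)) + 1 =
      (of_nat p * of_int (1 + (\<Sum>a\<in>{1..<p}. fermat_quotient p a)) :: rat)"
    using arg_cong[OF S, of "of_int :: int \<Rightarrow> rat"] by simp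
  finally have "padic_cong p (Suc 1) (of_nat p * bernoulli (p - 1) + 1)
      (of_nat p * of_int (1 + (\<Sum>a\<in>{1..<p}. fermat_quotient p a)))"
    by (simp add: numeral_2_eq_2)
  from padic_cong_divide_prime[OF p(1) this] show ?thesis
    using p3 by simp
qed

section \<open>Eulerian numbers modulo a prime\<close>

lemma card_ascents_less:
  assumes "n \<ge> 1" shows "card (ascents n f) < n"
proof -
  have "ascents n f \<subseteq> {1..<n}" by (auto simp: ascents_def)
  then have "card (ascents n f) \<le> card {1..<n}" by (intro card_mono) auto
  then show ?thesis using assms by simp
qed

text \<open>This is the evaluation at \<open>- 1\<close>, written through coefficients since a
  formal power series has no value there; the degree is below \<open>n\<close>.\<close>

lemma signed_ascent_sum_eq:
  assumes "n \<ge> 1"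
  shows "(\<Sum>f | f permutes {1..n}. (- 1) ^ card (ascents n f)) =
           (\<Sum>k<n. (- 1) ^ k * fps_nth (ascent_gf (n + 1) 1) k)"
proof -
  have "(\<Sum>k<n. (- 1) ^ k * fps_nth (ascent_gf (n + 1) 1) k) =
      (\<Sum>k<n. \<Sum>f | f permutes {1..n}. if k = card (ascents n f) then (- 1) ^ k else 0)"
    unfolding sum_ascent_gf[OF assms] fps_sum_nth sum_distrib_left
    by (intro sum.cong refl) auto
  also have "\<dots> = (\<Sum>f | f permutes {1..n}. \<Sum>k<n. if k = card (ascents n f) then (- 1) ^ k else 0)"
    by (rule sum.swap)
  also have "\<dots> = (\<Sum>f | f permutes {1..n}. (- 1) ^ card (ascents n f))"
    by (intro sum.cong refl) (simp add: card_ascents_less[OF assms])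
  finally show ?thesis by simp
qed

text \<open>By Pascal's rule neighbouring entries of row \<open>p - 1\<close> add up to an entry of
  row \<open>p\<close> divisible by \<open>p\<close>, so the sign alternates.\<close>

lemma choose_prime_minus_one_cong:
  assumes p: "prime p" and "k < p"
  shows "[int (p - 1 choose k) = (- 1) ^ k] (mod int p)"
  using assms(2)
proof (induction k)
  case (Suc k)
  have "p dvd (p choose Suc k)"
    using Suc.prems p by (intro dvd_choose_prime) auto
  moreover have "p choose Suc k = (p - 1 choose k) + (p - 1 choose Suc k)"
    using Suc.prems by (cases p) auto
  ultimately have "int p dvd int (p - 1 choose k) + int (p - 1 choose Suc k)"
    by (metis of_nat_add of_nat_dvd_iff)
  moreover have "int p dvd int (p - 1 choose k) - (- 1) ^ k"
    using Suc by (simp add: cong_iff_dvd_diff)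
  ultimately have "int p dvd int (p - 1 choose k) + int (p - 1 choose Suc k) -
      (int (p - 1 choose k) - (- 1) ^ k)"
    by (rule dvd_diff)
  then show ?case by (simp add: cong_iff_dvd_diff)
qed simp

lemma one_minus_fps_X_power_nth:
  "fps_nth ((1 - fps_X) ^ n :: int fps) k = (- 1) ^ k * int (n choose k)"
proof (induction n arbitrary: k)
  case 0
  then show ?case by (cases k) auto
next
  case (Suc n)
  then show ?case by (cases k) (auto simp: left_diff_distrib algebra_simps)
qed

text \<open>Modulo \<open>p\<close>, the factor \<open>(1 - X)\<^bsup>p - 1\<^esup>\<close> is \<open>1 + X + \<dots> + X\<^bsup>p - 1\<^esup>\<close>, and \<open>(i + 1)\<^bsup>p - 2\<^esup>\<close> is \<open>1 / (i + 1)\<close>.\<close>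
lemma eulerian_cong_harmonic:
  assumes p: "prime p" "p \<ge> 3" and k: "k < p"
  shows "[fps_nth (ascent_gf (p - 1) 1) k = (\<Sum>i\<le>k. (int i + 1) ^ (p - 2))] (mod int p)"
proof -
  have "ascent_gf (p - 1) 1 = Abs_fps (\<lambda>m. (int m + 1) ^ (p - 2)) * (1 - fps_X) ^ (p - 1)"
    using p by (subst ascent_gf_eq) (auto simp: mult.commute numeral_2_eq_2)
  then have "fps_nth (ascent_gf (p - 1) 1) k =
      (\<Sum>i\<le>k. (int i + 1) ^ (p - 2) * ((- 1) ^ (k - i) * int (p - 1 choose (k - i))))"
    by (simp add: fps_mult_nth one_minus_fps_X_power_nth atLeast0AtMost)
  also have "[\<dots> = (\<Sum>i\<le>k. (int i + 1) ^ (p - 2) * ((- 1) ^ (k - i) * (- 1) ^ (k - i)))] (mod int p)"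
    using k by (intro cong_sum cong_mult cong_refl choose_prime_minus_one_cong p) auto
  finally show ?thesis by (simp flip: power_mult_distrib)
qed

text \<open>Consecutive partial sums with opposite signs differ by one term, of even index; for the
  harmonic sums this keeps the odd denominators.\<close>

lemma alternating_sum_partial_sums:
  fixes h :: "nat \<Rightarrow> 'a::comm_ring_1"
  shows "(\<Sum>k<2 * s + 1. (- 1) ^ k * (\<Sum>i\<le>k. h i)) = (\<Sum>j\<le>s. h (2 * j))"
proof (induction s)
  case (Suc s)
  have "2 * Suc s + 1 = Suc (Suc (2 * s + 1))" by simp
  then have "(\<Sum>k<2 * Suc s + 1. (- 1) ^ k * (\<Sum>i\<le>k. h i)) =
      (\<Sum>k<2 * s + 1. (- 1) ^ k * (\<Sum>i\<le>k. h i)) + h (2 * Suc s)"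
    by (simp only: sum.lessThan_Suc) simp
  then show ?case using Suc.IH by simp
qed simp

lemma fermat_quotient_two_cong:
  assumes p: "prime p" "p = 2 * s + 3"
  shows "[fermat_quotient p 2 = (\<Sum>j\<le>s. (int (2 * j) + 1) ^ (p - 2))] (mod int p)"
proof -
  define c where "c i = (p choose i) div p" for i
  have c: "p choose i = p * c i" if "1 \<le> i" "i < p" for i
    using that p dvd_choose_prime[of i p] by (simp add: c_def)
  have "\<not> p dvd 2" using p by (auto dest: dvd_imp_le)
  then have "int p * fermat_quotient p 2 = 2 ^ (p - 1) - 1"
    using times_fermat_quotient[OF p(1)] by simp
  also have "2 ^ (p - 1) = (\<Sum>i\<le>p. if odd i then int (p choose i) else 0)"
  proof -
    have "2 * (\<Sum>i\<le>p. if odd i then int (p choose i) else 0) = 2 ^ p"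
      using p by (intro choose_odd_sum) auto
    also have "(2::int) ^ p = 2 * 2 ^ (p - 1)" using p by (simp flip: power_Suc)
    finally show ?thesis by simp
  qed
  also have "(\<Sum>i\<le>p. if odd i then int (p choose i) else 0) =
      (\<Sum>j\<le>s + 1. int (p choose (2 * j + 1)))"
  proof -
    have "(\<Sum>i | i \<in> {..p} \<and> odd i. g i) = (\<Sum>j\<le>s + 1. g (2 * j + 1))" for g :: "nat \<Rightarrow> int"
      by (rule sum.reindex_bij_witness[where i = "\<lambda>j. 2 * j + 1" and j = "\<lambda>i. i div 2"])
         (use p(2) in \<open>auto elim!: oddE\<close>)
    then show ?thesis
      unfolding sum.inter_filter[OF finite_atMost, symmetric] .
  qed
  \<comment> \<open>The index \<open>j = s + 1\<close> stands for \<open>p choose p\<close>; it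
    cancels the \<open>- 1\<close> of the Fermat quotient, and \<open>p\<close> divides all the
    others.\<close>
  also have "\<dots> = 1 + (\<Sum>j\<le>s. int (p choose (2 * j + 1)))"
  proof -
    have "2 * (s + 1) + 1 = p" using p(2) by simp
    then have "p choose (2 * (s + 1) + 1) = 1" by (simp only: binomial_n_n)
    moreover have "(\<Sum>j\<le>s + 1. g j) = g (s + 1) + (\<Sum>j\<le>s. g j)" for g :: "nat \<Rightarrow> int"
      by simp
    ultimately show ?thesis by (simp only: of_nat_1)
  qed
  also have "(\<Sum>j\<le>s. int (p choose (2 * j + 1))) = int p * (\<Sum>j\<le>s. int (c (2 * j + 1)))"
    unfolding sum_distrib_left
  proof (intro sum.cong refl)
    fix j assume "j \<in> {..s}"
    then have "2 * j + 1 < p" using p(2) by simp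
    then show "int (p choose (2 * j + 1)) = int p * int (c (2 * j + 1))"
      using c[of "2 * j + 1"] by (simp only: of_nat_mult le_add2)
  qed
  finally have "fermat_quotient p 2 = (\<Sum>j\<le>s. int (c (2 * j + 1)))"
    using prime_gt_0_nat[OF p(1)] by simp
  also have "[\<dots> = (\<Sum>j\<le>s. (int (2 * j) + 1) ^ (p - 2))] (mod int p)"
  proof (rule cong_sum)
    fix j assume "j \<in> {..s}"
    then have j: "2 * j + 1 \<in> {1..<p}" using p(2) by auto
    define i where "i = 2 * j + 1"
    have "p choose i = p * c i" using c[of i] j by (simp add: i_def)
    \<comment> \<open>Absorption reduces \<open>i * c i\<close> to an entry of row
      \<open>p - 1\<close> at an even place, which is \<open>1\<close> modulo \<open>p\<close>; thus
      \<open>c i\<close> is the inverse of \<open>i\<close>.\<close>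
    then have "p * (i * c i) = i * (p choose i)" by (simp only: mult.left_commute)
    also have "\<dots> = p * (p - 1 choose (2 * j))"
      by (subst times_binomial_minus1_eq) (auto simp: i_def)
    finally have "i * c i = (p - 1 choose (2 * j))"
      using nat_mult_eq_cancel1[OF prime_gt_0_nat[OF p(1)]] by blast
    then have "[int i * int (c i) = 1] (mod int p)"
      using choose_prime_minus_one_cong[OF p(1), of "2 * j"] j
      by (simp flip: of_nat_mult)
    moreover have "[int i ^ (p - 1) = 1] (mod int p)"
      using j by (intro fermat_theorem_int p not_dvd_if_in_range) (simp add: i_def)
    ultimately have "[int i * int (c i) = int i ^ (p - 1)] (mod int p)"
      using cong_sym cong_trans by blast
    also have "p - 1 = Suc (p - 2)" using p(2) by simp
    also have "int i ^ Suc (p - 2) = int i * int i ^ (p - 2)" by (rule power_Suc)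
    finally have "[int i * int (c i) = int i * int i ^ (p - 2)] (mod int p)" .
    moreover have "coprime (int i) (int p)"
      using not_dvd_if_in_range[OF j] p(1) prime_imp_coprime[of p i]
      by (simp add: i_def coprime_commute del: of_nat_Suc of_nat_add)
    ultimately have "[int (c i) = int i ^ (p - 2)] (mod int p)"
      using cong_mult_lcancel by blast
    then show "[int (c (2 * j + 1)) = (int (2 * j) + 1) ^ (p - 2)] (mod int p)"
      by (simp add: i_def add.commute)
  qed
  finally show ?thesis .
qed

section \<open>The permutation count modulo \<open>p\<close>\<close>

text \<open>Adding \<open>1\<close> to every sign counts even permutations twice and odd ones not at
  all, in the sense of ascent parity. The \<open>- 2\<close> removes the identity, whose
  \<open>n - 1\<close> ascents are even in number.\<close>

lemma two_M_eq:
  assumes "odd n"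
  shows "2 * int (M n) = (\<Sum>f | f permutes {1..n}. (- 1) ^ card (ascents n f)) + fact n - 2"
proof -
  let ?P = "{f. f permutes {1..n}}" and ?E = "{f. f permutes {1..n} \<and> even (card (ascents n f))}"
  have fin: "finite ?P" by (rule finite_permutations) simp
  then have finE: "finite ?E" by (rule rev_finite_subset) auto
  have "ascents n id = {1..<n}" by (auto simp: ascents_def)
  then have id: "id \<in> ?E" using assms by (simp add: permutes_id)
  have "even_ascent_perms n = ?E - {id}" by (auto simp: even_ascent_perms_def)
  then have M: "card ?E = M n + 1"
    using card.remove[OF finE id] by (simp add: M_def)
  have "(\<Sum>f\<in>?P. (- 1) ^ card (ascents n f)) + int (card ?P) =
      (\<Sum>f\<in>?P. (- 1) ^ card (ascents n f) + 1)"
    by (simp add: sum.distrib)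
  also have "\<dots> = (\<Sum>f\<in>?P. if even (card (ascents n f)) then 2 else 0)"
    by (intro sum.cong) auto
  also have "\<dots> = 2 * int (card ?E)"
    using fin by (simp add: sum.If_cases Int_def)
  finally show ?thesis
    using M card_permutations[of "{1..n}" n] by simp
qed

lemma two_M_cong:
  assumes p: "prime p" "odd p"
  shows "[2 * int (M (p - 2)) = fermat_quotient p 2 - 1] (mod int p)"
proof -
  have "p \<ge> 3" using p prime_ge_2_nat[of p] by (cases "p = 2") auto
  then obtain s where s: "p = 2 * s + 3"
    using p by (metis add_diff_inverse_nat even_add evenE leD odd_numeral add.commute)
  have n: "p - 2 = 2 * s + 1" "p - 2 + 1 = p - 1" using s by auto
  have "(\<Sum>f | f permutes {1..p - 2}. (- 1) ^ card (ascents (p - 2) f)) =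
      (\<Sum>k<2 * s + 1. (- 1) ^ k * fps_nth (ascent_gf (p - 1) 1) k)"
    using signed_ascent_sum_eq[of "p - 2"] n by simp
  also have "[\<dots> = (\<Sum>k<2 * s + 1. (- 1) ^ k * (\<Sum>i\<le>k. (int i + 1) ^ (p - 2)))] (mod int p)"
    using s by (intro cong_sum cong_mult cong_refl eulerian_cong_harmonic p) auto
  also have "(\<Sum>k<2 * s + 1. (- 1) ^ k * (\<Sum>i\<le>k. (int i + 1) ^ (p - 2))) =
      (\<Sum>j\<le>s. (int (2 * j) + 1) ^ (p - 2))"
    by (rule alternating_sum_partial_sums)
  also have "[\<dots> = fermat_quotient p 2] (mod int p)"
    by (rule cong_sym[OF fermat_quotient_two_cong[OF p(1) s]])
  finally have D: "[(\<Sum>f | f permutes {1..p - 2}. (- 1) ^ card (ascents (p - 2) f)) =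
      fermat_quotient p 2] (mod int p)" .
  \<comment> \<open>Wilson's theorem gives \<open>- 1\<close> for \<open>fact (p - 1)\<close>;
    cancelling the factor \<open>p - 1\<close>, also \<open>- 1\<close> modulo \<open>p\<close>,
    leaves \<open>fact (p - 2)\<close> congruent to \<open>1\<close>.\<close>
  have "p - 1 = Suc (p - 2)" using s by simp
  then have "fact (p - 1) = (int p - 1) * fact (p - 2)"
    using s by (simp only: fact_Suc) (simp add: of_nat_diff)
  then have "int p * fact (p - 2) - (fact (p - 1) + 1) = fact (p - 2) - 1"
    by (simp add: algebra_simps)
  moreover have "int p dvd fact (p - 1) + 1"
    using wilson_theorem[OF p(1)] by (simp add: cong_iff_dvd_diff)
  ultimately have F: "[fact (p - 2) = 1] (mod int p)"
    unfolding cong_iff_dvd_diff by (metis dvd_diff dvd_triv_left)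
  have "odd (p - 2)" using n by simp
  have "[2 * int (M (p - 2)) = fermat_quotient p 2 + 1 - 2] (mod int p)"
    unfolding two_M_eq[OF \<open>odd (p - 2)\<close>] by (intro cong_diff cong_add D F cong_refl)
  then show ?thesis by simp
qed

theorem mainTheorem1:
  fixes p :: nat
  assumes "prime p" and "odd p"
  shows "padic_cong p 1
           (\<Sum>k = 1..p - 2. divided_bernoulli k / 2 ^ k)
           ((of_nat p * bernoulli (p - 1) + 1) / of_nat p + 2 * of_nat (M (p - 2)))"
proof -
  note p = assms
  define Q where "Q = (\<Sum>a\<in>{1..<p}. fermat_quotient p a)"
  have "padic_cong p 1 (\<Sum>k = 1..p - 2. divided_bernoulli k / 2 ^ k)
      (\<Sum>k = 1..p - 2.
        of_int (- (\<Sum>a\<in>{1..<p}. int a ^ k * fermat_quotient p a) * 2 ^ (p - 1 - k)))"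
    by (intro padic_cong_sum divided_bernoulli_cong p) auto
  also have "(\<Sum>k = 1..p - 2.
        of_int (- (\<Sum>a\<in>{1..<p}. int a ^ k * fermat_quotient p a) * 2 ^ (p - 1 - k))) =
      (of_int (\<Sum>k = 1..p - 2.
        - (\<Sum>a\<in>{1..<p}. int a ^ k * fermat_quotient p a) * 2 ^ (p - 1 - k)) :: rat)"
    by (rule of_int_sum [symmetric])
  finally have L: "padic_cong p 1 (\<Sum>k = 1..p - 2. divided_bernoulli k / 2 ^ k)
      (of_int (Q + fermat_quotient p 2))"
    unfolding Q_def using sum_fermat_quotients_cong[OF p]
    by (elim padic_cong_trans[OF p(1)], intro padic_cong_of_int p) simp
  \<comment> \<open>The \<open>1\<close> from the Agoh-Giuga quotient cancels the \<open>- 1\<close>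
    from \<open>two_M_cong\<close>, which leaves the integer already found for the left-hand
    side.\<close>
  have "padic_cong p 1 ((of_nat p * bernoulli (p - 1) + 1) / of_nat p +
        of_int (2 * int (M (p - 2))))
      (of_int (1 + Q) + of_int (fermat_quotient p 2 - 1))"
    unfolding Q_def
    by (intro padic_cong_add agoh_giuga_cong padic_cong_of_int p)
       (simp only: power_one_right two_M_cong[OF p])
  then have "padic_cong p 1 ((of_nat p * bernoulli (p - 1) + 1) / of_nat p +
        2 * of_nat (M (p - 2))) (of_int (Q + fermat_quotient p 2))"
    by (simp add: algebra_simps)
  then show ?thesis using L padic_cong_sym padic_cong_trans p(1) by blast
qed

end
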